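(* Let $\Omega$ be a locally compact Hausdorff space, $\sigma$ a Radon measure on $\Omega$, and $0<q<1$. Suppose $G:\Omega\times\Omega\to[0,+\infty]$ is a lower semicontinuous kernel satisfying the weak maximum principle with constant $\mathfrak{b}\ge1$. If $u\in L^q_{\mathrm{loc}}(\sigma)$, $u>0$, satisfies $$u\ge G(u^q d\sigma)\quad\text{in }\Omega,$$ then $$u(x)\ \ge\ (1-q)^{\frac1{1-q}}\,\mathfrak{b}^{-\frac{q}{1-q}}\,\big[G\sigma(x)\big]^{\frac1{1-q}},\qquad x\in\Omega .$$
   Context: For a measure $\nu$ on $\Omega$ write $G\nu(x)=\int_\Omega G(x,y)\,d\nu(y)$; for measurable $f\ge0$ write $G(f\,d\sigma)(x)=\int_\Omega G(x,y)f(y)\,d\sigma(y)$. $u\in L^q_{\mathrm{loc}}(\sigma)$ means that $u$ is measurable and $\int_F |u|^q d\sigma<+\infty$ for every compact $F\subset\Omega$. Weak maximum principle with constant $\mathfrak{b}\ge1$: for any Radon measure $\nu$ in $\Omega$ with compact support $K=\mathrm{supp}(\nu)$, if $G\nu\le 1$ in $K$, then $G\nu\le\mathfrak{b}$ in $\Omega$. *)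

theory Defs
  imports "HOL-Analysis.Analysis"
begin

text \<open>The underlying space is the whole type, with its topology given by the type class.
  Radon measures are Borel measures in the sense of the Riesz representation theorem on locally
  compact Hausdorff spaces; in particular they need not be sigma-finite.\<close>

definition radon_measure :: "'a::topological_space measure \<Rightarrow> bool" where
  "radon_measure \<nu> \<longleftrightarrow>
     sets \<nu> = sets borel \<and>
     (\<forall>K. compact K \<longrightarrow> emeasure \<nu> K < \<infinity>) \<and>
     (\<forall>A\<in>sets borel. emeasure \<nu> A = (INF U\<in>{U. open U \<and> A \<subseteq> U}. emeasure \<nu> U)) \<and>
     (\<forall>U. open U \<longrightarrow> emeasure \<nu> U = (SUP K\<in>{K. compact K \<and> K \<subseteq> U}. emeasure \<nu> K))"

definition measure_support :: "'a::topological_space measure \<Rightarrow> 'a set" where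
  "measure_support \<nu> = {x. \<forall>U. open U \<longrightarrow> x \<in> U \<longrightarrow> 0 < emeasure \<nu> U}"

definition lower_semicontinuous :: "('a::topological_space \<Rightarrow> ennreal) \<Rightarrow> bool" where
  "lower_semicontinuous f \<longleftrightarrow> (\<forall>t. open {x. t < f x})"

text \<open>Powers of extended nonnegative reals with \<open>\<infinity>\<close> raised to a power equal to \<open>\<infinity>\<close>
  (and \<open>0\<close> to \<open>0\<close>); only meaningful for exponents \<open>p > 0\<close>.\<close>

definition enn_powr :: "ennreal \<Rightarrow> real \<Rightarrow> ennreal" where
  "enn_powr a p = (if a = \<infinity> then \<infinity> else ennreal (enn2real a powr p))"

definition potential :: "('a \<times> 'a \<Rightarrow> ennreal) \<Rightarrow> 'a measure \<Rightarrow> 'a \<Rightarrow> ennreal" where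
  "potential G \<nu> x = (\<integral>\<^sup>+y. G (x, y) \<partial>\<nu>)"

definition weighted_potential ::
    "('a \<times> 'a \<Rightarrow> ennreal) \<Rightarrow> ('a \<Rightarrow> ennreal) \<Rightarrow> 'a measure \<Rightarrow> 'a \<Rightarrow> ennreal" where
  "weighted_potential G f \<sigma> x = (\<integral>\<^sup>+y. G (x, y) * f y \<partial>\<sigma>)"

definition weak_maximum_principle ::
    "('a::topological_space \<times> 'a \<Rightarrow> ennreal) \<Rightarrow> real \<Rightarrow> bool" where
  "weak_maximum_principle G b \<longleftrightarrow>
     (\<forall>\<nu>. radon_measure \<nu> \<longrightarrow> compact (measure_support \<nu>) \<longrightarrow>
        (\<forall>x\<in>measure_support \<nu>. potential G \<nu> x \<le> 1) \<longrightarrow>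
        (\<forall>x. potential G \<nu> x \<le> ennreal b))"

text \<open>Membership in \<open>L\<^sup>q\<close> locally, for nonnegative functions; the value \<open>\<infinity>\<close> is allowed
  (necessarily on a null subset of each compact set when \<open>q > 0\<close>).\<close>

definition Lq_loc :: "real \<Rightarrow> 'a::topological_space measure \<Rightarrow> ('a \<Rightarrow> ennreal) set" where
  "Lq_loc q \<sigma> = {u. u \<in> borel_measurable \<sigma> \<and>
     (\<forall>F. compact F \<longrightarrow> (\<integral>\<^sup>+y\<in>F. enn_powr (u y) q \<partial>\<sigma>) < \<infinity>)}"

end

theory Submission
  imports Defs
begin

text \<open>Put \<open>d\<nu> = u\<^sup>q d\<sigma>\<close>. On \<open>{u \<le> t}\<close> we have \<open>G\<nu> \<le> u \<le> t\<close>, so the weak maximum principle, applied to the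
  restrictions of \<open>\<nu>\<close> to compact subsets, bounds the potential of \<open>\<nu>\<close> restricted to \<open>{u \<le> t}\<close> by
  \<open>min (b t) (u x)\<close> at every point \<open>x\<close>. As \<open>d\<sigma> = u powr (-q) d\<nu>\<close> and \<open>u powr (-q)\<close> is the integral of
  \<open>q t powr (-q - 1)\<close> over \<open>t \<ge> u\<close>, Fubini gives
  \<open>G\<sigma>(x) \<le> \<integral> q t powr (-q - 1) min (b t) (u x) dt = b powr q / (1 - q) * u x powr (1 - q)\<close>.
  Where \<open>u x < \<infinity>\<close>, the measure \<open>G(x, \<cdot>) d\<nu>\<close> is finite, which supplies the sigma-finiteness that \<open>\<sigma>\<close>
  itself may lack.\<close>

section \<open>Regularity of Radon measures and integrals over compact subsets\<close>

lemma nn_integral_UN_incseq_le: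
  assumes "incseq C" and [measurable]: "\<And>n. C n \<in> sets M" "h \<in> borel_measurable M"
    and le: "\<And>n::nat. (\<integral>\<^sup>+y. h y * indicator (C n) y \<partial>M) \<le> c"
  shows "(\<integral>\<^sup>+y. h y * indicator (\<Union>n. C n) y \<partial>M) \<le> c"
proof -
  have "(\<integral>\<^sup>+y. h y * indicator (\<Union>n. C n) y \<partial>M) = emeasure (density M h) (\<Union>n. C n)"
    by (simp add: emeasure_density)
  also have "\<dots> = (SUP n. emeasure (density M h) (C n))"
    using assms(1,2) by (intro SUP_emeasure_incseq[symmetric]) auto
  also have "\<dots> \<le> c" by (intro SUP_least) (simp add: emeasure_density le)
  finally show ?thesis .
qed

lemma radon_measureD:
  assumes "radon_measure \<nu>"
  shows radon_measure_sets: "sets \<nu> = sets borel"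
    and radon_measure_compact: "compact K \<Longrightarrow> emeasure \<nu> K < \<infinity>"
    and radon_measure_outer: "A \<in> sets borel \<Longrightarrow>
      emeasure \<nu> A = (INF U\<in>{U. open U \<and> A \<subseteq> U}. emeasure \<nu> U)"
    and radon_measure_inner: "open U \<Longrightarrow>
      emeasure \<nu> U = (SUP K\<in>{K. compact K \<and> K \<subseteq> U}. emeasure \<nu> K)"
  using assms unfolding radon_measure_def Ball_def by iprover+

lemma radon_measure_outer_approx:
  fixes \<nu> :: "'a::t2_space measure"
  assumes "radon_measure \<nu>" "A \<in> sets borel" "emeasure \<nu> A < \<infinity>" "0 < e"
  obtains U where "open U" "A \<subseteq> U" "emeasure \<nu> (U - A) < ennreal e"
proof -
  have sets: "sets \<nu> = sets borel" using assms(1) by (rule radon_measure_sets)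
  have "emeasure \<nu> A = (INF U\<in>{U. open U \<and> A \<subseteq> U}. emeasure \<nu> U)"
    using assms(1,2) by (rule radon_measure_outer)
  from INF_approx_ennreal[OF \<open>0 < e\<close> this] assms(3)
  obtain U where U: "open U" "A \<subseteq> U" "emeasure \<nu> U < emeasure \<nu> A + ennreal e"
    by (auto simp: less_top)
  have "emeasure \<nu> U = emeasure \<nu> A + emeasure \<nu> (U - A)"
    using plus_emeasure[of A \<nu> "U - A"] U assms(2) sets by (auto simp: Un_absorb1)
  with U have "emeasure \<nu> A + emeasure \<nu> (U - A) < emeasure \<nu> A + ennreal e" by simp
  then have "emeasure \<nu> (U - A) < ennreal e"
    \<comment> \<open>Contrapositive: a remainder of at least \<open>e\<close> would, after adding
      \<open>emeasure \<nu> A\<close>, contradict the strict inequality; no subtraction in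
      \<open>ennreal\<close> is needed.\<close>
    by (meson add_left_mono not_le)
  with U that show thesis by blast
qed

lemma radon_measure_inner_approx_open:
  fixes \<nu> :: "'a::t2_space measure"
  assumes "radon_measure \<nu>" "open U" "emeasure \<nu> U < \<infinity>" "0 < e"
  obtains C where "compact C" "C \<subseteq> U" "emeasure \<nu> (U - C) < ennreal e"
proof -
  have sets: "sets \<nu> = sets borel" using assms(1) by (rule radon_measure_sets)
  have sup: "emeasure \<nu> U = (SUP K\<in>{K. compact K \<and> K \<subseteq> U}. emeasure \<nu> K)"
    using assms(1,2) by (rule radon_measure_inner)
  have "{K. compact K \<and> K \<subseteq> U} \<noteq> {}" by (auto intro: exI[of _ "{}"])
  from SUP_approx_ennreal[OF \<open>0 < e\<close> this sup] assms(3)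
  obtain C where C: "compact C" "C \<subseteq> U" "emeasure \<nu> U < emeasure \<nu> C + ennreal e"
    by (auto simp: less_top)
  have "C \<in> sets borel" by (simp add: C compact_imp_closed borel_closed)
  then have "emeasure \<nu> U = emeasure \<nu> C + emeasure \<nu> (U - C)"
    using plus_emeasure[of C \<nu> "U - C"] C assms(2) sets by (auto simp: Un_absorb1)
  with C have "emeasure \<nu> C + emeasure \<nu> (U - C) < emeasure \<nu> C + ennreal e" by simp
  then have "emeasure \<nu> (U - C) < ennreal e"
    by (meson add_left_mono not_le)
  with C that show thesis by blast
qed

text \<open>The definition grants inner regularity on open sets only. To reach a Borel set
  \<open>A\<close> of finite measure, enclose it in an open \<open>U\<close>, enclose the excess
  \<open>U - A\<close> in an open \<open>V\<close> of small measure, and approximate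
  \<open>U\<close> from inside by a compact \<open>C\<close>. Then \<open>C - V\<close> is compact,
  and it lies in \<open>A\<close> because \<open>V\<close> swallows \<open>U - A\<close>. What is
  lost is covered by \<open>U - C\<close>, \<open>V - (U - A)\<close> and \<open>U - A\<close>, each
  of measure below \<open>e / 3\<close>.\<close>

lemma radon_measure_inner_approx:
  fixes \<nu> :: "'a::t2_space measure"
  assumes rad: "radon_measure \<nu>" and A: "A \<in> sets borel" "emeasure \<nu> A < \<infinity>" and "0 < e"
  obtains K where "compact K" "K \<subseteq> A" "emeasure \<nu> (A - K) < ennreal e"
proof -
  have sets [measurable_cong]: "sets \<nu> = sets borel" using rad by (rule radon_measure_sets)
  note A(1) [measurable]
  have e3: "0 < e / 3" using \<open>0 < e\<close> by simp
  obtain U where U: "open U" "A \<subseteq> U" "emeasure \<nu> (U - A) < ennreal (e / 3)"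
    using radon_measure_outer_approx[OF rad A e3] .
  have [measurable]: "U \<in> sets borel" using U by simp
  have UA: "U - A \<in> sets borel" by measurable
  have "emeasure \<nu> (U - A) < \<infinity>" using U(3) by (auto intro: less_trans)
  then obtain V where V: "open V" "U - A \<subseteq> V" "emeasure \<nu> (V - (U - A)) < ennreal (e / 3)"
    using radon_measure_outer_approx[OF rad UA _ e3] by blast
  have "emeasure \<nu> U \<le> emeasure \<nu> A + emeasure \<nu> (U - A)"
    using emeasure_subadditive[of A \<nu> "U - A"] U by (auto simp: Un_absorb1 sets A(1))
  also have "\<dots> < \<infinity>"
    using A(2) \<open>emeasure \<nu> (U - A) < \<infinity>\<close> by (simp add: ennreal_add_less_top)
  finally obtain C where C: "compact C" "C \<subseteq> U" "emeasure \<nu> (U - C) < ennreal (e / 3)"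
    using radon_measure_inner_approx_open[OF rad U(1) _ e3] by blast
  have [measurable]: "V \<in> sets borel" "C \<in> sets borel"
    by (simp_all add: V C compact_imp_closed borel_closed)
  have "emeasure \<nu> (A - (C - V)) \<le> emeasure \<nu> ((U - C) \<union> ((V - (U - A)) \<union> (U - A)))"
    by (rule emeasure_mono) (use U in \<open>auto simp: sets\<close>)
  also have "\<dots> \<le> emeasure \<nu> (U - C) + (emeasure \<nu> (V - (U - A)) + emeasure \<nu> (U - A))"
    by (intro order_trans[OF emeasure_subadditive] add_mono order_refl emeasure_subadditive; measurable)
  also have "\<dots> < ennreal (e / 3) + (ennreal (e / 3) + ennreal (e / 3))"
    using C V U by (intro add_strict_mono)
  also have "\<dots> = ennreal e" using e3 by (simp flip: ennreal_plus)
  finally have "emeasure \<nu> (A - (C - V)) < ennreal e" .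
  moreover have "compact (C - V)" using C V by (simp add: compact_diff)
  moreover have "C - V \<subseteq> A" using C V by blast
  ultimately show thesis using that by blast
qed

text \<open>A compact set filling \<open>A\<close> up to small measure says nothing about the
  integral of \<open>h\<close>, which may be infinite here. Instead countably many compact sets
  exhaust \<open>A\<close> up to a null set; their finite unions \<open>C n\<close> are still
  compact and increase, so monotone convergence carries the bound over to \<open>A\<close>.\<close>

lemma radon_measure_nn_integral_inner_regular_finite:
  fixes \<nu> :: "'a::t2_space measure"
  assumes rad: "radon_measure \<nu>" and A: "A \<in> sets borel" "emeasure \<nu> A < \<infinity>"
    and h [measurable]: "h \<in> borel_measurable \<nu>"
    and le: "\<And>K. compact K \<Longrightarrow> K \<subseteq> A \<Longrightarrow> (\<integral>\<^sup>+y. h y * indicator K y \<partial>\<nu>) \<le> c"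
  shows "(\<integral>\<^sup>+y. h y * indicator A y \<partial>\<nu>) \<le> c"
proof -
  have sets [measurable_cong]: "sets \<nu> = sets borel" using rad by (rule radon_measure_sets)
  note A(1) [measurable]
  have "\<exists>K. compact K \<and> K \<subseteq> A \<and> emeasure \<nu> (A - K) < ennreal (1 / real (Suc n))" for n
  proof -
    have "0 < 1 / real (Suc n)" by simp
    from radon_measure_inner_approx[OF rad A this] show ?thesis by metis
  qed
  then obtain K where K: "\<And>n. compact (K n)" "\<And>n. K n \<subseteq> A"
      "\<And>n. emeasure \<nu> (A - K n) < ennreal (1 / real (Suc n))"
    by metis
  define C where "C n = (\<Union>i\<le>n. K i)" for n
  have C: "compact (C n)" "C n \<subseteq> A" for n
    using K(1,2) by (auto simp: C_def intro!: compact_UN)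
  have [measurable]: "C n \<in> sets borel" for n
    by (simp add: C compact_imp_closed borel_closed)
  have "incseq C" unfolding incseq_def C_def by (intro allI impI UN_mono) auto
  have "emeasure \<nu> (A - (\<Union>n. C n)) \<le> ennreal (1 / real (Suc n))" for n
  proof -
    have "emeasure \<nu> (A - (\<Union>n. C n)) \<le> emeasure \<nu> (A - K n)"
      using K(1) compact_imp_closed by (intro emeasure_mono) (auto simp: C_def sets A)
    with K(3)[of n] show ?thesis by simp
  qed
  moreover have "(\<lambda>n. ennreal (1 / real (Suc n))) \<longlonglongrightarrow> ennreal 0"
    by (intro tendsto_ennrealI LIMSEQ_Suc lim_1_over_n)
  ultimately have "emeasure \<nu> (A - (\<Union>n. C n)) \<le> ennreal 0"
    by (intro LIMSEQ_le_const) auto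
  then have null: "A - (\<Union>n. C n) \<in> null_sets \<nu>" by (auto simp: null_sets_def sets A)
  have "(\<integral>\<^sup>+y. h y * indicator A y \<partial>\<nu>) = (\<integral>\<^sup>+y. h y * indicator (\<Union>n. C n) y \<partial>\<nu>)"
    by (rule nn_integral_cong_AE, rule AE_mp[OF AE_not_in[OF null]])
       (use C in \<open>auto split: split_indicator\<close>)
  also have "\<dots> \<le> c"
    by (intro nn_integral_UN_incseq_le \<open>incseq C\<close> le C) auto
  finally show ?thesis .
qed

text \<open>A Radon measure in the present sense need not be inner regular on Borel sets of
  infinite measure; integrability of \<open>h\<close> makes \<open>{h > 0}\<close> sigma-finite.\<close>

lemma radon_measure_nn_integral_inner_regular:
  fixes \<nu> :: "'a::t2_space measure"
  assumes rad: "radon_measure \<nu>" and A [measurable]: "A \<in> sets borel"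
    and h [measurable]: "h \<in> borel_measurable \<nu>" and fin: "(\<integral>\<^sup>+y. h y \<partial>\<nu>) < \<infinity>"
    and le: "\<And>K. compact K \<Longrightarrow> K \<subseteq> A \<Longrightarrow> (\<integral>\<^sup>+y. h y * indicator K y \<partial>\<nu>) \<le> c"
  shows "(\<integral>\<^sup>+y. h y * indicator A y \<partial>\<nu>) \<le> c"
proof -
  have sets [measurable_cong]: "sets \<nu> = sets borel" using rad by (rule radon_measure_sets)
  then have space: "space \<nu> = UNIV" by (metis sets_eq_imp_space_eq space_borel)
  \<comment> \<open>This is the part of \<open>A\<close> where \<open>h\<close> is at least
    \<open>1 / n\<close>, written without division so that \<open>B 0\<close> is empty. By Markov's
    inequality each \<open>B n\<close> has finite measure, and the sets increase to the part of
    \<open>A\<close> where \<open>h\<close> is positive.\<close>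
  define B where "B n = A \<inter> {y. 1 \<le> of_nat n * h y}" for n :: nat
  have hb [measurable]: "h \<in> borel_measurable borel" using h sets by (simp cong: measurable_cong_sets)
  have B [measurable]: "B n \<in> sets borel" for n unfolding B_def by measurable
  have Bfin: "emeasure \<nu> (B n) < \<infinity>" for n
  proof -
    have "emeasure \<nu> (B n) \<le> emeasure \<nu> {y\<in>UNIV. 1 \<le> of_nat n * h y}"
      by (rule emeasure_mono) (auto simp: B_def sets)
    also have "\<dots> \<le> of_nat n * (\<integral>\<^sup>+y. h y * indicator UNIV y \<partial>\<nu>)"
      using nn_integral_Markov_inequality[of h UNIV \<nu> "of_nat n"] by (simp add: sets space)
    also have "\<dots> < \<infinity>" using fin by (simp add: ennreal_mult_less_top of_nat_less_top)
    finally show ?thesis .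
  qed
  have "incseq B"
    unfolding incseq_def B_def
    by (intro allI impI Int_mono order_refl Collect_mono, erule order_trans) (simp add: mult_right_mono)
  have UB: "h y * indicator A y = h y * indicator (\<Union>n. B n) y" for y
  proof (cases "h y = 0")
    case False
    have "\<exists>n::nat. 1 \<le> of_nat n * h y"
    \<comment> \<open>An infinite value needs its own case: there \<open>1 / h y\<close> is
      \<open>0\<close>, and the cancellation \<open>1 / h y * h y = 1\<close> fails.\<close>
    proof (cases "h y = \<infinity>")
      case True
      then show ?thesis by (intro exI[of _ 1]) simp
    next
      case fin: False
      have "1 / h y \<noteq> top" using False by (simp add: ennreal_divide_eq_top_iff)
      then obtain n :: nat where "1 / h y < of_nat n"
        using ennreal_Ex_less_of_nat by (auto simp: less_top)
      then have "1 / h y * h y \<le> of_nat n * h y" by (intro mult_right_mono) auto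
      moreover have "1 / h y * h y = 1"
        using False fin by (simp add: ennreal_divide_times ennreal_divide_self less_top)
      ultimately show ?thesis by auto
    qed
    then show ?thesis by (auto simp: B_def split: split_indicator)
  qed simp
  have "(\<integral>\<^sup>+y. h y * indicator A y \<partial>\<nu>) = (\<integral>\<^sup>+y. h y * indicator (\<Union>n. B n) y \<partial>\<nu>)"
    by (simp only: UB)
  also have "\<dots> \<le> c"
  proof (rule nn_integral_UN_incseq_le[OF \<open>incseq B\<close> _ h])
    show "B n \<in> sets \<nu>" for n by (simp add: sets)
    show "(\<integral>\<^sup>+y. h y * indicator (B n) y \<partial>\<nu>) \<le> c" for n
    proof (rule radon_measure_nn_integral_inner_regular_finite[OF rad B Bfin h])
      fix K assume "compact K" "K \<subseteq> B n"
      then show "(\<integral>\<^sup>+y. h y * indicator K y \<partial>\<nu>) \<le> c" using le[of K] by (simp add: B_def)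
    qed
  qed
  finally show ?thesis .
qed

section \<open>Densities cut off to compact sets, and the weak maximum principle for them\<close>

text \<open>The weak maximum principle speaks of Radon measures only, so the truncated densities
  must be shown to be Radon. The new measure is at most \<open>c\<close> times \<open>\<nu>\<close>
  restricted to \<open>K\<close>, hence finite, and sets whose difference inside \<open>K\<close> is
  small for \<open>\<nu>\<close> have close measures. Both regularity properties thus follow from
  those of \<open>\<nu>\<close> on subsets of \<open>K\<close>.\<close>

lemma radon_measure_density_compact:
  fixes \<nu> :: "'a::t2_space measure"
  assumes rad: "radon_measure \<nu>" and f [measurable]: "f \<in> borel_measurable \<nu>"
    and K: "compact K" and c: "0 \<le> c" and le: "\<And>y. y \<in> K \<Longrightarrow> f y \<le> ennreal c"
  shows "radon_measure (density \<nu> (\<lambda>y. f y * indicator K y))" (is "radon_measure ?\<mu>")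
proof -
  have sets [measurable_cong]: "sets \<nu> = sets borel" using rad by (rule radon_measure_sets)
  have Kb [measurable]: "K \<in> sets borel" using K by (simp add: compact_imp_closed borel_closed)
  have Kfin: "emeasure \<nu> K < \<infinity>" using rad K by (rule radon_measure_compact)
  have bound: "emeasure ?\<mu> B \<le> ennreal c * emeasure \<nu> (B \<inter> K)" if [measurable]: "B \<in> sets borel" for B
  proof -
    have "emeasure ?\<mu> B = (\<integral>\<^sup>+y. f y * indicator K y * indicator B y \<partial>\<nu>)"
      by (simp add: emeasure_density)
    also have "\<dots> \<le> (\<integral>\<^sup>+y. ennreal c * indicator (B \<inter> K) y \<partial>\<nu>)"
      by (intro nn_integral_mono) (auto simp: le split: split_indicator)
    finally show ?thesis by (simp add: nn_integral_cmult)
  qed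
  have fin: "emeasure ?\<mu> B < \<infinity>" if B [measurable]: "B \<in> sets borel" for B
  proof -
    have "ennreal c * emeasure \<nu> (B \<inter> K) \<le> ennreal c * emeasure \<nu> K"
      by (intro mult_left_mono emeasure_mono) (auto simp: sets)
    also have "\<dots> < \<infinity>" using Kfin by (simp add: ennreal_mult_less_top)
    finally show ?thesis using bound[OF B] by simp
  qed
  \<comment> \<open>Dividing by \<open>c + 1\<close> instead of \<open>c\<close> keeps the tolerance
    meaningful when \<open>c = 0\<close>.\<close>
  have small: "emeasure ?\<mu> B \<le> emeasure ?\<mu> A + ennreal e"
    if [measurable]: "A \<in> sets borel" "B \<in> sets borel" and "0 < e"
      and less: "emeasure \<nu> ((B - A) \<inter> K) < ennreal (e / (c + 1))" for A B e
  proof -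
    have "emeasure ?\<mu> B \<le> emeasure ?\<mu> (A \<union> (B - A))"
      by (rule emeasure_mono) (auto simp: sets)
    also have "\<dots> \<le> emeasure ?\<mu> A + emeasure ?\<mu> (B - A)"
      by (rule emeasure_subadditive) (auto simp: sets)
    also have "emeasure ?\<mu> (B - A) \<le> ennreal c * emeasure \<nu> ((B - A) \<inter> K)"
      by (rule bound) measurable
    also have "\<dots> \<le> ennreal c * ennreal (e / (c + 1))"
      using less by (intro mult_left_mono) auto
    also have "\<dots> = ennreal (c * (e / (c + 1)))"
      using c \<open>0 < e\<close> by (intro ennreal_mult[symmetric]) auto
    also have "\<dots> \<le> ennreal e"
      using c \<open>0 < e\<close> by (intro ennreal_leI) (simp add: field_simps)
    finally show ?thesis by (simp add: add_left_mono)
  qed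
  have e': "0 < e / (c + 1)" if "0 < e" for e :: real using that c by simp
  show ?thesis
    unfolding radon_measure_def
  proof (intro conjI allI ballI impI)
    show "sets ?\<mu> = sets borel" using sets by simp
    show "emeasure ?\<mu> C < \<infinity>" if "compact C" for C
      using that by (intro fin) (simp add: compact_imp_closed borel_closed)
  next
    fix A :: "'a set" assume A [measurable]: "A \<in> sets borel"
    show "emeasure ?\<mu> A = (INF U\<in>{U. open U \<and> A \<subseteq> U}. emeasure ?\<mu> U)"
    proof (rule antisym)
      show "emeasure ?\<mu> A \<le> (INF U\<in>{U. open U \<and> A \<subseteq> U}. emeasure ?\<mu> U)"
        by (intro INF_greatest emeasure_mono) (auto simp: sets)
      show "(INF U\<in>{U. open U \<and> A \<subseteq> U}. emeasure ?\<mu> U) \<le> emeasure ?\<mu> A"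
      proof (rule ennreal_le_epsilon)
        fix e :: real assume "0 < e"
        have "emeasure \<nu> (A \<inter> K) \<le> emeasure \<nu> K" by (intro emeasure_mono) (auto simp: sets)
        then have "emeasure \<nu> (A \<inter> K) < \<infinity>" using Kfin by simp
        then obtain U where U: "open U" "A \<inter> K \<subseteq> U"
            "emeasure \<nu> (U - A \<inter> K) < ennreal (e / (c + 1))"
          using radon_measure_outer_approx[OF rad _ _ e'[OF \<open>0 < e\<close>], of "A \<inter> K"] A Kb by blast
        have [measurable]: "U \<in> sets borel" using U by simp
        \<comment> \<open>\<open>U\<close> covers only \<open>A \<inter> K\<close>. Adding the open
          complement of \<open>K\<close> covers the rest of \<open>A\<close> at no cost, since the
          density vanishes there.\<close>
        have W: "open (U \<union> - K)" using U K by (simp add: compact_imp_closed open_Un open_Compl)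
        have "(INF U\<in>{U. open U \<and> A \<subseteq> U}. emeasure ?\<mu> U) \<le> emeasure ?\<mu> (U \<union> - K)"
          using U W by (intro INF_lower) auto
        also have "\<dots> \<le> emeasure ?\<mu> A + ennreal e"
        proof (rule small[OF A _ \<open>0 < e\<close>])
          show "U \<union> - K \<in> sets borel" using W by simp
          have "emeasure \<nu> (((U \<union> - K) - A) \<inter> K) \<le> emeasure \<nu> (U - A \<inter> K)"
            by (intro emeasure_mono) (auto simp: sets)
          with U show "emeasure \<nu> (((U \<union> - K) - A) \<inter> K) < ennreal (e / (c + 1))" by simp
        qed
        finally show "(INF U\<in>{U. open U \<and> A \<subseteq> U}. emeasure ?\<mu> U) \<le> emeasure ?\<mu> A + ennreal e" .
      qed
    qed
  next
    fix U :: "'a set" assume U: "open U"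
    have [measurable]: "U \<in> sets borel" using U by simp
    show "emeasure ?\<mu> U = (SUP C\<in>{C. compact C \<and> C \<subseteq> U}. emeasure ?\<mu> C)"
    proof (rule antisym)
      show "(SUP C\<in>{C. compact C \<and> C \<subseteq> U}. emeasure ?\<mu> C) \<le> emeasure ?\<mu> U"
        by (intro SUP_least emeasure_mono) (auto simp: sets)
      show "emeasure ?\<mu> U \<le> (SUP C\<in>{C. compact C \<and> C \<subseteq> U}. emeasure ?\<mu> C)"
      proof (rule ennreal_le_epsilon)
        fix e :: real assume "0 < e"
        have "emeasure \<nu> (U \<inter> K) \<le> emeasure \<nu> K" by (intro emeasure_mono) (auto simp: sets)
        then have UK: "emeasure \<nu> (U \<inter> K) < \<infinity>" using Kfin by simp
        \<comment> \<open>\<open>U \<inter> K\<close> need not be open, so the approximation of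
          Borel sets of finite measure is used in place of the defining property for open
          sets.\<close>
        have UKb: "U \<inter> K \<in> sets borel" by measurable
        obtain C where C: "compact C" "C \<subseteq> U \<inter> K"
            "emeasure \<nu> (U \<inter> K - C) < ennreal (e / (c + 1))"
          using radon_measure_inner_approx[OF rad UKb UK e'[OF \<open>0 < e\<close>]] .
        have Cb [measurable]: "C \<in> sets borel" by (simp add: C compact_imp_closed borel_closed)
        have "emeasure ?\<mu> U \<le> emeasure ?\<mu> C + ennreal e"
        proof (rule small[OF Cb _ \<open>0 < e\<close>])
          show "U \<in> sets borel" by measurable
          have "(U - C) \<inter> K = U \<inter> K - C" by auto
          with C show "emeasure \<nu> ((U - C) \<inter> K) < ennreal (e / (c + 1))" by simp
        qed
        also have "emeasure ?\<mu> C \<le> (SUP C\<in>{C. compact C \<and> C \<subseteq> U}. emeasure ?\<mu> C)"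
          using C by (intro SUP_upper) auto
        finally show "emeasure ?\<mu> U \<le> (SUP C\<in>{C. compact C \<and> C \<subseteq> U}. emeasure ?\<mu> C) + ennreal e"
          by (simp add: add_right_mono)
      qed
    qed
  qed
qed

lemma closed_measure_support: "closed (measure_support \<nu>)"
proof -
  have "- measure_support \<nu> = \<Union>{U. open U \<and> emeasure \<nu> U = 0}"
    by (auto simp: measure_support_def zero_less_iff_neq_zero)
  moreover have "open (\<Union>{U. open U \<and> emeasure \<nu> U = 0})" by (intro open_Union) auto
  ultimately show ?thesis by (simp add: closed_def)
qed

lemma measure_support_density_subset:
  assumes "closed K" "sets \<nu> = sets borel" "f \<in> borel_measurable \<nu>"
  shows "measure_support (density \<nu> (\<lambda>y. f y * indicator K y)) \<subseteq> K"
proof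
  fix x assume x: "x \<in> measure_support (density \<nu> (\<lambda>y. f y * indicator K y))"
  have [measurable]: "K \<in> sets \<nu>" "- K \<in> sets \<nu>" using assms by auto
  have "emeasure (density \<nu> (\<lambda>y. f y * indicator K y)) (- K)
      = (\<integral>\<^sup>+y. f y * indicator K y * indicator (- K) y \<partial>\<nu>)"
    using assms(3) by (intro emeasure_density) auto
  also have "\<dots> = (\<integral>\<^sup>+y. 0 \<partial>\<nu>)"
    by (intro nn_integral_cong) (auto split: split_indicator)
  finally show "x \<in> K" using x assms(1) by (auto simp: measure_support_def open_Compl)
qed

text \<open>Dividing the density by \<open>t\<close> normalises the bound on the potential to
  \<open>1\<close>; the bound \<open>c\<close> for \<open>f\<close> on \<open>K\<close> makes the
  truncated measure Radon. Its support lies in \<open>K\<close>, and truncation only lowers the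
  potential, so the hypothesis of the maximum principle holds on the support. Multiplying back by
  \<open>t\<close> gives the claim.\<close>

lemma weak_maximum_principle_density:
  fixes \<nu> :: "'a::t2_space measure"
  assumes rad: "radon_measure \<nu>" and wmp: "weak_maximum_principle G b"
    and G: "\<And>x. (\<lambda>y. G (x, y)) \<in> borel_measurable borel"
    and f: "f \<in> borel_measurable \<nu>"
    and K: "compact K" and c: "0 \<le> c" "\<And>y. y \<in> K \<Longrightarrow> f y \<le> ennreal c"
    and t: "0 < t" and le: "\<And>y. y \<in> K \<Longrightarrow> weighted_potential G f \<nu> y \<le> ennreal t"
  shows "(\<integral>\<^sup>+y. G (x, y) * f y * indicator K y \<partial>\<nu>) \<le> ennreal t * ennreal b"
proof -
  have sets [measurable_cong]: "sets \<nu> = sets borel" using rad by (rule radon_measure_sets)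
  note G [measurable] f [measurable]
  have [measurable]: "K \<in> sets borel" using K by (simp add: compact_imp_closed borel_closed)
  define \<mu> where "\<mu> = density \<nu> (\<lambda>y. ennreal (1 / t) * f y * indicator K y)"
  have pot: "potential G \<mu> x = ennreal (1 / t) * (\<integral>\<^sup>+y. G (x, y) * f y * indicator K y \<partial>\<nu>)" for x
    unfolding potential_def \<mu>_def
    by (subst nn_integral_density, simp, simp, subst nn_integral_cmult[symmetric])
       (auto intro!: nn_integral_cong simp: ac_simps)
  have rad\<mu>: "radon_measure \<mu>"
    unfolding \<mu>_def
  proof (rule radon_measure_density_compact[OF rad _ K])
    show "0 \<le> 1 / t * c" using c t by simp
    show "ennreal (1 / t) * f y \<le> ennreal (1 / t * c)" if "y \<in> K" for y
    proof -
      have "ennreal (1 / t) * f y \<le> ennreal (1 / t) * ennreal c"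
        using c that by (intro mult_left_mono) auto
      also have "\<dots> = ennreal (1 / t * c)" using c t by (intro ennreal_mult[symmetric]) auto
      finally show ?thesis .
    qed
  qed measurable
  have sub: "measure_support \<mu> \<subseteq> K"
    unfolding \<mu>_def using K
    by (intro measure_support_density_subset) (auto simp: compact_imp_closed sets)
  then have "compact (measure_support \<mu>)"
    using K closed_Int_compact[OF closed_measure_support[of \<mu>] K] by (simp add: Int_absorb2)
  moreover have "potential G \<mu> y \<le> 1" if "y \<in> measure_support \<mu>" for y
  proof -
    have "(\<integral>\<^sup>+z. G (y, z) * f z * indicator K z \<partial>\<nu>) \<le> weighted_potential G f \<nu> y"
      unfolding weighted_potential_def by (intro nn_integral_mono) (auto split: split_indicator)
    also have "\<dots> \<le> ennreal t" using le that sub by auto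
    finally have "potential G \<mu> y \<le> ennreal (1 / t) * ennreal t"
      unfolding pot by (intro mult_left_mono) auto
    also have "\<dots> = 1" using t by (simp flip: ennreal_mult)
    finally show ?thesis .
  qed
  ultimately have "potential G \<mu> x \<le> ennreal b"
    using wmp rad\<mu> unfolding weak_maximum_principle_def by blast
  then have "ennreal t * potential G \<mu> x \<le> ennreal t * ennreal b" by (intro mult_left_mono) auto
  moreover have "ennreal t * potential G \<mu> x = (\<integral>\<^sup>+y. G (x, y) * f y * indicator K y \<partial>\<nu>)"
    unfolding pot mult.assoc[symmetric] using t by (simp flip: ennreal_mult)
  ultimately show ?thesis by simp
qed

section \<open>One-dimensional integrals over the levels \<open>t\<close>\<close>

lemma nn_integral_powr_layer_cake:
  assumes "0 < q" "0 < r"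
  shows "(\<integral>\<^sup>+t. ennreal (q * t powr (- q - 1)) * indicator {r..} t \<partial>lborel) = ennreal (r powr (- q))"
proof -
  have "((\<lambda>t. q * t powr (- q - 1)) has_integral q * (- (r powr (- q - 1 + 1)) / (- q - 1 + 1))) {r..}"
    using assms by (intro has_integral_mult_right has_integral_powr_to_inf) auto
  then have "((\<lambda>t. q * t powr (- q - 1)) has_integral r powr (- q)) {r..}"
    using assms by simp
  from nn_integral_has_integral_lebesgue'[OF _ this] show ?thesis
    using assms by simp
qed

text \<open>The two bounds on \<open>S\<close> cross at \<open>c = M / b\<close>. The linear one is
  integrated up to \<open>c\<close>, where \<open>q < 1\<close> gives convergence at
  \<open>0\<close>; the constant one is integrated beyond \<open>c\<close>, where
  \<open>0 < q\<close> gives convergence at infinity. The pieces are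
  \<open>q * b * c powr (1 - q) / (1 - q)\<close> and \<open>b * c powr (1 - q)\<close>.\<close>

lemma nn_integral_powr_min_le:
  fixes S :: "real \<Rightarrow> ennreal"
  assumes "0 < q" "q < 1" "0 < b" "0 < M"
    and S1: "\<And>t. 0 < t \<Longrightarrow> S t \<le> ennreal (b * t)" and S2: "\<And>t. 0 < t \<Longrightarrow> S t \<le> ennreal M"
  shows "(\<integral>\<^sup>+t. ennreal (q * t powr (- q - 1)) * indicator {0<..} t * S t \<partial>lborel)
      \<le> ennreal (b powr q / (1 - q) * M powr (1 - q))"
proof -
  define c where "c = M / b"
  have c: "0 < c" and Mc: "M = b * c" using assms by (auto simp: c_def)
  have int0: "(\<integral>\<^sup>+t. ennreal (t powr (- q)) * indicator {0..c} t \<partial>lborel)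
      = ennreal (c powr (1 - q) / (1 - q))"
    using nn_integral_has_integral_lebesgue'[OF _ has_integral_powr_from_0[of "- q" c]] assms c
    by simp
  \<comment> \<open>Both closed intervals contain \<open>c\<close>, which is harmless because only
    an upper bound is sought.\<close>
  have "(\<integral>\<^sup>+t. ennreal (q * t powr (- q - 1)) * indicator {0<..} t * S t \<partial>lborel)
      \<le> (\<integral>\<^sup>+t. ennreal (q * b) * (ennreal (t powr (- q)) * indicator {0..c} t)
            + ennreal M * (ennreal (q * t powr (- q - 1)) * indicator {c..} t) \<partial>lborel)"
  proof (rule nn_integral_mono)
    fix t :: real
    consider "t \<le> 0" | "0 < t" "t \<le> c" | "c < t" using c by linarith
    then show "ennreal (q * t powr (- q - 1)) * indicator {0<..} t * S t
       \<le> ennreal (q * b) * (ennreal (t powr (- q)) * indicator {0..c} t)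
            + ennreal M * (ennreal (q * t powr (- q - 1)) * indicator {c..} t)"
    proof cases
      case 2
      have "ennreal (q * t powr (- q - 1)) * S t \<le> ennreal (q * t powr (- q - 1)) * ennreal (b * t)"
        using S1 2 by (intro mult_left_mono) auto
      also have "\<dots> = ennreal (q * b * (t powr (- q - 1) * t powr 1))"
        using 2 assms by (simp add: ac_simps flip: ennreal_mult)
      also have "\<dots> = ennreal (q * b) * ennreal (t powr (- q))"
        using assms unfolding powr_add[symmetric] by (simp add: ennreal_mult')
      finally show ?thesis using 2 by (auto intro: order_trans split: split_indicator)
    next
      case 3
      have "ennreal (q * t powr (- q - 1)) * S t \<le> ennreal (q * t powr (- q - 1)) * ennreal M"
        using S2 3 c by (intro mult_left_mono) auto
      then show ?thesis using 3 c by (auto simp: mult.commute)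
    qed simp
  qed
  also have "\<dots> = ennreal (q * b) * ennreal (c powr (1 - q) / (1 - q)) + ennreal M * ennreal (c powr (- q))"
    using nn_integral_powr_layer_cake[OF \<open>0 < q\<close> c] int0
    by (simp add: nn_integral_add nn_integral_cmult)
  also have "\<dots> = ennreal (q * b * (c powr (1 - q) / (1 - q)) + M * c powr (- q))"
    using assms by (simp flip: ennreal_mult ennreal_plus)
  also have "q * b * (c powr (1 - q) / (1 - q)) + M * c powr (- q) = b * c powr (1 - q) / (1 - q)"
  proof -
    have "c * c powr (- q) = c powr (1 - q)" using c by (simp add: powr_diff powr_minus field_simps)
    then show ?thesis using assms(2) by (simp add: Mc field_simps)
  qed
  also have "b * c powr (1 - q) / (1 - q) = b powr q / (1 - q) * M powr (1 - q)"
    using assms c by (simp add: c_def powr_divide powr_diff field_simps)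
  finally show ?thesis .
qed

section \<open>Measurability of kernel sections and extended powers\<close>

text \<open>Sections suffice: the later use of Fubini exchanges a point \<open>y\<close> with a
  level \<open>t\<close> and never treats \<open>G\<close> as a function of two variables, so no
  product sigma-algebra on the square of the space enters.\<close>

lemma borel_measurable_lower_semicontinuous_section:
  fixes G :: "'a::topological_space \<times> 'b::topological_space \<Rightarrow> ennreal"
  assumes "lower_semicontinuous G"
  shows "(\<lambda>y. G (x, y)) \<in> borel_measurable borel"
proof (rule borel_measurableI_greater)
  fix t :: ennreal
  have "open (Pair x -` {p. t < G p})"
    using assms by (intro open_vimage) (auto simp: lower_semicontinuous_def intro!: continuous_intros)
  then show "{y \<in> space borel. t < G (x, y)} \<in> sets borel" by (simp add: vimage_def)
qed

lemma borel_measurable_enn_powr: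
  assumes [measurable]: "f \<in> borel_measurable M"
  shows "(\<lambda>y. enn_powr (f y) p) \<in> borel_measurable M"
  unfolding enn_powr_def by measurable

lemma enn_powr_ennreal: "0 \<le> r \<Longrightarrow> enn_powr (ennreal r) p = ennreal (r powr p)"
  by (simp add: enn_powr_def)

lemma enn_powr_mono:
  assumes "a \<le> c" "0 \<le> p"
  shows "enn_powr a p \<le> enn_powr c p"
proof (cases "c = \<infinity>")
  case False
  with assms(1) have "a \<noteq> \<infinity>" by (auto simp: top_unique)
  with False assms show ?thesis
    by (auto simp: enn_powr_def less_top intro!: ennreal_leI powr_mono2 enn2real_mono)
qed (simp add: enn_powr_def)

section \<open>The upper bound for the potential of \<open>\<sigma>\<close> where the supersolution
  is finite\<close>

lemma potential_le_of_supersolution: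
  fixes \<sigma> :: "'a::t2_space measure"
  assumes rad: "radon_measure \<sigma>" and q: "0 < q" "q < 1"
    and G: "\<And>x. (\<lambda>y. G (x, y)) \<in> borel_measurable borel"
    and b: "1 \<le> b" and wmp: "weak_maximum_principle G b"
    and u [measurable]: "u \<in> borel_measurable \<sigma>" and pos: "\<And>y. 0 < u y"
    and super: "\<And>y. weighted_potential G (\<lambda>z. enn_powr (u z) q) \<sigma> y \<le> u y"
    and M: "0 < M" "u x = ennreal M"
  shows "potential G \<sigma> x \<le> ennreal (b powr q / (1 - q) * M powr (1 - q))"
proof -
  have sets [measurable_cong]: "sets \<sigma> = sets borel" using rad by (rule radon_measure_sets)
  have ub [measurable]: "u \<in> borel_measurable borel"
    using u sets by (simp cong: measurable_cong_sets)
  note G [measurable] borel_measurable_enn_powr [measurable]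
  \<comment> \<open>With \<open>x\<close> fixed, the supersolution inequality at \<open>x\<close>
    says that \<open>h\<close> has integral at most \<open>u x = M\<close>. The measure with this
    density is therefore finite.\<close>
  define h where "h y = G (x, y) * enn_powr (u y) q" for y
  have h [measurable]: "h \<in> borel_measurable borel" unfolding h_def by measurable
  have h' [measurable]: "h \<in> borel_measurable \<sigma>" by measurable
  have hM: "(\<integral>\<^sup>+y. h y \<partial>\<sigma>) \<le> ennreal M"
    using super[of x] M by (simp add: weighted_potential_def h_def)
  define \<mu> where "\<mu> = density \<sigma> h"
  have \<mu>: "emeasure \<mu> A = (\<integral>\<^sup>+y. h y * indicator A y \<partial>\<sigma>)" if "A \<in> sets borel" for A
    unfolding \<mu>_def using that by (intro emeasure_density) (auto simp: sets)
  have [measurable_cong]: "sets \<mu> = sets borel" by (simp add: \<mu>_def sets)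
  have E [measurable]: "{y. u y \<le> ennreal t} \<in> sets borel" for t by measurable

  have level_M: "emeasure \<mu> {y. u y \<le> ennreal t} \<le> ennreal M" for t
  proof -
    have "emeasure \<mu> {y. u y \<le> ennreal t} \<le> (\<integral>\<^sup>+y. h y \<partial>\<sigma>)"
      unfolding \<mu>[OF E] by (intro nn_integral_mono) (auto split: split_indicator)
    with hM show ?thesis by simp
  qed
  \<comment> \<open>On a compact subset of the level set, \<open>u\<close> is at most
    \<open>t\<close>; this bounds the density by \<open>t powr q\<close> and, through the
    supersolution inequality, the potential by \<open>t\<close>. Inner regularity for the integrable
    \<open>h\<close> then extends the estimate to the whole level set.\<close>
  have level_t: "emeasure \<mu> {y. u y \<le> ennreal t} \<le> ennreal (b * t)" if t: "0 < t" for t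
    unfolding \<mu>[OF E]
  proof (rule radon_measure_nn_integral_inner_regular[OF rad E h'])
    show "(\<integral>\<^sup>+y. h y \<partial>\<sigma>) < \<infinity>" using hM by (simp add: le_less_trans)
    fix K assume K: "compact K" "K \<subseteq> {y. u y \<le> ennreal t}"
    have "(\<integral>\<^sup>+y. G (x, y) * enn_powr (u y) q * indicator K y \<partial>\<sigma>) \<le> ennreal t * ennreal b"
    proof (rule weak_maximum_principle_density[OF rad wmp G _ K(1) _ _ t])
      show "enn_powr (u y) q \<le> ennreal (t powr q)" if "y \<in> K" for y
        using enn_powr_mono[of "u y" "ennreal t" q] K that q t by (auto simp: enn_powr_ennreal)
      show "weighted_potential G (\<lambda>y. enn_powr (u y) q) \<sigma> y \<le> ennreal t" if "y \<in> K" for y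
        using super[of y] K(2) that by (auto intro: order_trans)
    qed auto
    then show "(\<integral>\<^sup>+y. h y * indicator K y \<partial>\<sigma>) \<le> ennreal (b * t)"
      using b t by (simp add: h_def ennreal_mult mult.commute)
  qed

  \<comment> \<open>Cutting off at \<open>0\<close> loses nothing: for \<open>t \<le> 0\<close> the
    value \<open>ennreal t\<close> is \<open>0\<close>, and \<open>u\<close> is positive.\<close>
  define k where "k t = ennreal (q * t powr (- q - 1)) * indicator {0<..} t" for t :: real
  have k [measurable]: "k \<in> borel_measurable borel" unfolding k_def by measurable
  \<comment> \<open>This plays the role of \<open>u powr (-q)\<close>. Where \<open>u\<close> is
    infinite no real level reaches it, so \<open>w\<close> is \<open>0\<close> there.\<close>
  define w where "w y = (\<integral>\<^sup>+t. k t * indicator {y. u y \<le> ennreal t} y \<partial>lborel)" for y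
  have w: "w y = ennreal (r powr (- q))" if "u y = ennreal r" "0 < r" for y r
  proof -
    have "w y = (\<integral>\<^sup>+t. ennreal (q * t powr (- q - 1)) * indicator {r..} t \<partial>lborel)"
      unfolding w_def k_def using that
      by (intro nn_integral_cong) (auto simp: ennreal_le_iff2 split: split_indicator)
    then show ?thesis using nn_integral_powr_layer_cake[OF q(1) that(2)] by simp
  qed
  have pair [measurable]: "(\<lambda>(y, t). k t * indicator {y. u y \<le> ennreal t} y)
      \<in> borel_measurable (\<mu> \<Otimes>\<^sub>M lborel)"
    by measurable
  interpret \<mu>: finite_measure \<mu>
  proof
    show "emeasure \<mu> (space \<mu>) \<noteq> \<infinity>"
      using hM \<mu>[of UNIV] sets_eq_imp_space_eq[of \<mu> borel]
      by (auto simp: \<mu>_def sets top_unique)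
  qed
  interpret pair_sigma_finite \<mu> lborel ..

  \<comment> \<open>Where \<open>u y\<close> is finite, the powers cancel and
    \<open>h y * w y\<close> equals \<open>G (x, y)\<close>. Where \<open>u y\<close> is infinite,
    so is its power, and finiteness of \<open>h y\<close> forces
    \<open>G (x, y) = 0\<close>.\<close>
  have "AE y in \<sigma>. h y \<noteq> \<infinity>"
    using hM by (intro nn_integral_PInf_AE) (auto simp: top_unique)
  then have "AE y in \<sigma>. G (x, y) \<le> h y * w y"
  proof (rule AE_mp, intro AE_I2 impI)
    fix y assume hy: "h y \<noteq> \<infinity>"
    show "G (x, y) \<le> h y * w y"
    proof (cases "u y")
      case (real r)
      with pos[of y] have r: "0 < r" by (auto simp: less_le)
      have "h y * w y = G (x, y) * (ennreal (r powr q) * ennreal (r powr (- q)))"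
        using w[OF real(2) r] r by (simp add: h_def real enn_powr_ennreal mult.assoc)
      also have "ennreal (r powr q) * ennreal (r powr (- q)) = 1"
        using r by (simp add: powr_minus flip: ennreal_mult)
      finally show ?thesis by simp
    next
      case top
      with hy have "G (x, y) = 0"
        by (auto simp: h_def enn_powr_def ennreal_mult_eq_top_iff)
      then show ?thesis by simp
    qed
  qed
  then have "potential G \<sigma> x \<le> (\<integral>\<^sup>+y. h y * w y \<partial>\<sigma>)"
    unfolding potential_def by (rule nn_integral_mono_AE)
  also have "\<dots> = (\<integral>\<^sup>+y. w y \<partial>\<mu>)"
    unfolding \<mu>_def by (rule nn_integral_density[symmetric]) (simp_all add: w_def)
  also have "\<dots> = (\<integral>\<^sup>+t. \<integral>\<^sup>+y. k t * indicator {y. u y \<le> ennreal t} y \<partial>\<mu> \<partial>lborel)"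
    unfolding w_def using Fubini[OF pair] by simp
  also have "\<dots> = (\<integral>\<^sup>+t. k t * emeasure \<mu> {y. u y \<le> ennreal t} \<partial>lborel)"
    by (intro nn_integral_cong) (simp add: nn_integral_cmult)
  also have "\<dots> \<le> ennreal (b powr q / (1 - q) * M powr (1 - q))"
    unfolding k_def using q b M level_t level_M by (intro nn_integral_powr_min_le) auto
  finally show ?thesis .
qed

theorem theorem1p3:
  fixes \<sigma> :: "'a::t2_space measure"
    and G :: "'a \<times> 'a \<Rightarrow> ennreal"
    and u :: "'a \<Rightarrow> ennreal"
    and q b :: real
  assumes "locally_compact_space (euclidean :: 'a topology)"
    and "radon_measure \<sigma>"
    and "0 < q" and "q < 1"
    and "lower_semicontinuous G"
    and "1 \<le> b"
    and "weak_maximum_principle G b"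
    and "u \<in> Lq_loc q \<sigma>"
    and "\<forall>x. 0 < u x"
    and "\<forall>x. weighted_potential G (\<lambda>y. enn_powr (u y) q) \<sigma> x \<le> u x"
  shows "\<forall>x. ennreal ((1 - q) powr (1 / (1 - q)) * b powr (- (q / (1 - q))))
               * enn_powr (potential G \<sigma> x) (1 / (1 - q)) \<le> u x"
proof
  fix x
  note q = assms(3,4)
  show "ennreal ((1 - q) powr (1 / (1 - q)) * b powr (- (q / (1 - q))))
               * enn_powr (potential G \<sigma> x) (1 / (1 - q)) \<le> u x" (is "ennreal ?C * _ \<le> _")
  proof (cases "u x")
    case (real M)
    with assms(9) have M: "0 < M" by (metis ennreal_0 less_le)
    let ?P = "b powr q / (1 - q) * M powr (1 - q)"
    have "potential G \<sigma> x \<le> ennreal ?P"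
      using assms(8,9,10) real
      by (intro potential_le_of_supersolution[where u = u] assms(2,3,4,6,7) M
          borel_measurable_lower_semicontinuous_section[OF assms(5)]) (auto simp: Lq_loc_def)
    then have "ennreal ?C * enn_powr (potential G \<sigma> x) (1 / (1 - q))
        \<le> ennreal ?C * enn_powr (ennreal ?P) (1 / (1 - q))"
      using q by (intro mult_left_mono enn_powr_mono) auto
    also have "\<dots> = ennreal (?C * ?P powr (1 / (1 - q)))"
      using q by (subst enn_powr_ennreal) (auto simp: ennreal_mult)
    \<comment> \<open>The constant \<open>?C\<close> is the reciprocal of
      \<open>(b powr q / (1 - q)) powr (1 / (1 - q))\<close>, so inverting the bound on the
      potential returns exactly \<open>M\<close>.\<close>
    also have "?C * ?P powr (1 / (1 - q)) = M"
      using q M assms(6) by (simp add: powr_mult powr_divide powr_powr powr_minus field_simps)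
    finally show ?thesis using real by simp
  qed simp
qed

end
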